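(* Let $I,X,Y$ be nonempty sets, $\mathbf C$ a nonempty set of functions $I\to X$, $\Omega$ a nonempty set of functions $I\to Y$, and $\mathcal X$ a nonempty family of subsets of $I$. Let $\mathbf M=\mathcal P(\mathbf C)^{\Omega}$, $\mathcal M\in\mathbf M$ and $\mathbf M_{\mathcal M}=\{\phi\in\mathbf M\mid\phi\sqsubseteq\mathcal M\}$. Define $\gamma:\mathbf M_{\mathcal M}\to\mathbf M_{\mathcal M}$ by $$\gamma(\phi)(\omega)=\bigcap_{A\in\mathcal X}\ \bigcup_{\substack{h\in\mathbf C\\ h|_A\in[\phi](-\omega|A)}}\phi(\omega)(h|A),\qquad \phi\in\mathbf M_{\mathcal M},\ \omega\in\Omega.$$ Let $\alpha$ be an ordinal with $|\mathbf M_{\mathcal M}|^+\le\alpha$. Then there exists a greatest (with respect to $\sqsubseteq$) $\mathcal X$-non-anticipating selection of $\mathcal M$, it is the greatest fixed point of $\gamma$, and it equals $\gamma^{\alpha}(\mathcal M)$.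
   Context: $\mathcal P(Z)$ is the power set of $Z$; $\mathbf M$ is the set of all multifunctions $\phi:\Omega\to\mathcal P(\mathbf C)$, ordered by $\phi\sqsubseteq\psi$ iff $\phi(\omega)\subset\psi(\omega)$ for all $\omega\in\Omega$; $\phi$ is a selection of $\psi$ iff $\phi\sqsubseteq\psi$. For a function $f$ on $I$ and $A\subset I$, $f|_A$ is its restriction to $A$; for a set $F$ of functions on $I$, $(F|A)=\{f|_A: f\in F\}$. For $\omega\in\Omega$, $H\subset\mathbf C$, $h\in\mathbf C$: $\Omega(\omega|A)=\{\nu\in\Omega\mid\nu|_A=\omega|_A\}$, $\Omega(-\omega|A)=\Omega(\omega|A)\setminus\{\omega\}$, $H(h|A)=\{f\in H\mid f|_A=h|_A\}$ (used with $H=\phi(\omega)$). For $\phi\in\mathbf M$, $[\phi](-\omega|A)=\bigcap_{\nu\in\Omega(-\omega|A)}(\phi(\nu)|A)$, where the intersection over the empty index set is taken to be $(\mathbf C|A)$. A multifunction $\phi\in\mathbf M$ is $\mathcal X$-non-anticipating iff for all $A\in\mathcal X$ and $\omega,\omega'\in\Omega$ with $\omega'|_A=\omega|_A$ one has $(\phi(\omega)|A)\subset(\phi(\omega')|A)$. For a set $H$, $|H|^+$ is the least ordinal whose cardinality is strictly greater than that of $H$. Transfinite iterates: $\gamma^0(\phi)=\phi$, $\gamma^{\beta+1}(\phi)=\gamma(\gamma^\beta(\phi))$, and for a limit ordinal $\lambda$, $\gamma^\lambda(\phi)$ is the greatest lower bound in $(\mathbf M_{\mathcal M},\sqsubseteq)$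 of $\{\gamma^\beta(\phi):\beta<\lambda\}$, i.e. $\gamma^\lambda(\phi)(\omega)=\bigcap_{\beta<\lambda}\gamma^\beta(\phi)(\omega)$. The axiom of choice is assumed. *)

theory Defs
  imports Main "HOL-Library.FuncSet"
begin

unbundle cardinal_syntax

text \<open>
  A function with domain \<open>I\<close> is an element of \<open>I \<rightarrow>\<^sub>E UNIV\<close>, that is, a total function which is
  \<^const>\<open>undefined\<close> outside \<open>I\<close>. For \<open>A \<subseteq> I\<close> the restriction \<open>f|\<^sub>A\<close> is \<^term>\<open>restrict f A\<close>.
\<close>

definition restr_set :: "('i \<Rightarrow> 'x) set \<Rightarrow> 'i set \<Rightarrow> ('i \<Rightarrow> 'x) set" where
  "restr_set F A = (\<lambda>f. restrict f A) ` F"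

definition agreeing :: "('i \<Rightarrow> 'x) set \<Rightarrow> ('i \<Rightarrow> 'x) \<Rightarrow> 'i set \<Rightarrow> ('i \<Rightarrow> 'x) set" where
  "agreeing H h A = {f \<in> H. restrict f A = restrict h A}"

type_synonym ('i, 'x, 'y) multifun = "('i \<Rightarrow> 'y) \<Rightarrow> ('i \<Rightarrow> 'x) set"

definition multifuns :: "('i \<Rightarrow> 'x) set \<Rightarrow> ('i \<Rightarrow> 'y) set \<Rightarrow> ('i, 'x, 'y) multifun set" where
  "multifuns C \<Omega> = \<Omega> \<rightarrow>\<^sub>E Pow C"

definition mf_le :: "('i \<Rightarrow> 'y) set \<Rightarrow> ('i, 'x, 'y) multifun \<Rightarrow> ('i, 'x, 'y) multifun \<Rightarrow> bool" where
  "mf_le \<Omega> \<phi> \<psi> \<longleftrightarrow> (\<forall>\<omega>\<in>\<Omega>. \<phi> \<omega> \<subseteq> \<psi> \<omega>)"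

definition selections ::
  "('i \<Rightarrow> 'x) set \<Rightarrow> ('i \<Rightarrow> 'y) set \<Rightarrow> ('i, 'x, 'y) multifun \<Rightarrow> ('i, 'x, 'y) multifun set" where
  "selections C \<Omega> M = {\<phi> \<in> multifuns C \<Omega>. mf_le \<Omega> \<phi> M}"

definition is_greatest ::
  "('i \<Rightarrow> 'y) set \<Rightarrow> ('i, 'x, 'y) multifun set \<Rightarrow> ('i, 'x, 'y) multifun \<Rightarrow> bool" where
  "is_greatest \<Omega> S \<phi> \<longleftrightarrow> \<phi> \<in> S \<and> (\<forall>\<psi>\<in>S. mf_le \<Omega> \<psi> \<phi>)"

definition non_anticipating ::
  "('i \<Rightarrow> 'y) set \<Rightarrow> 'i set set \<Rightarrow> ('i, 'x, 'y) multifun \<Rightarrow> bool" where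
  "non_anticipating \<Omega> \<X> \<phi> \<longleftrightarrow>
     (\<forall>A\<in>\<X>. \<forall>\<omega>\<in>\<Omega>. \<forall>\<omega>'\<in>\<Omega>. restrict \<omega>' A = restrict \<omega> A \<longrightarrow>
        restr_set (\<phi> \<omega>) A \<subseteq> restr_set (\<phi> \<omega>') A)"

text \<open>
  \<open>bracket C \<Omega> \<phi> \<omega> A\<close> is \<open>[\<phi>](-\<omega>|A)\<close>; an intersection over the empty index set is \<open>(C|A)\<close>.
\<close>

definition bracket ::
  "('i \<Rightarrow> 'x) set \<Rightarrow> ('i \<Rightarrow> 'y) set \<Rightarrow> ('i, 'x, 'y) multifun \<Rightarrow> ('i \<Rightarrow> 'y) \<Rightarrow> 'i set \<Rightarrow> ('i \<Rightarrow> 'x) set"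
where
  "bracket C \<Omega> \<phi> \<omega> A =
     (if agreeing \<Omega> \<omega> A - {\<omega>} = {} then restr_set C A
      else (\<Inter>\<nu>\<in>agreeing \<Omega> \<omega> A - {\<omega>}. restr_set (\<phi> \<nu>) A))"

definition gamma ::
  "('i \<Rightarrow> 'x) set \<Rightarrow> ('i \<Rightarrow> 'y) set \<Rightarrow> 'i set set \<Rightarrow> ('i, 'x, 'y) multifun \<Rightarrow> ('i, 'x, 'y) multifun"
where
  "gamma C \<Omega> \<X> \<phi> =
     (\<lambda>\<omega>\<in>\<Omega>. \<Inter>A\<in>\<X>. \<Union>h\<in>{h \<in> C. restrict h A \<in> bracket C \<Omega> \<phi> \<omega> A}. agreeing (\<phi> \<omega>) h A)"

lemma gamma_selections:
  assumes "\<X> \<noteq> {}" "\<phi> \<in> selections C \<Omega> M"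
  shows "gamma C \<Omega> \<X> \<phi> \<in> selections C \<Omega> M"
proof -
  have sub: "gamma C \<Omega> \<X> \<phi> \<omega> \<subseteq> \<phi> \<omega>" if "\<omega> \<in> \<Omega>" for \<omega>
    using that assms(1) by (auto simp: gamma_def agreeing_def)
  have "\<phi> \<omega> \<subseteq> C" "\<phi> \<omega> \<subseteq> M \<omega>" if "\<omega> \<in> \<Omega>" for \<omega>
    using that assms(2) by (auto simp: selections_def multifuns_def mf_le_def)
  with sub have "gamma C \<Omega> \<X> \<phi> \<omega> \<subseteq> C" "gamma C \<Omega> \<X> \<phi> \<omega> \<subseteq> M \<omega>" if "\<omega> \<in> \<Omega>" for \<omega>
    using that by blast+
  moreover have "gamma C \<Omega> \<X> \<phi> \<in> extensional \<Omega>"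
    by (simp add: gamma_def)
  ultimately show ?thesis
    by (auto simp: selections_def multifuns_def mf_le_def PiE_def Pi_def)
qed

definition mf_Inf :: "('i \<Rightarrow> 'y) set \<Rightarrow> ('i, 'x, 'y) multifun set \<Rightarrow> ('i, 'x, 'y) multifun" where
  "mf_Inf \<Omega> S = (\<lambda>\<omega>\<in>\<Omega>. \<Inter>\<phi>\<in>S. \<phi> \<omega>)"

lemma is_greatest_mf_Inf:
  assumes "S \<noteq> {}" "S \<subseteq> selections C \<Omega> M"
  shows "is_greatest \<Omega> {\<psi> \<in> selections C \<Omega> M. \<forall>\<phi>\<in>S. mf_le \<Omega> \<psi> \<phi>} (mf_Inf \<Omega> S)"
proof -
  have "mf_Inf \<Omega> S \<in> extensional \<Omega>"
    by (simp add: mf_Inf_def)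
  moreover obtain \<phi> where "\<phi> \<in> S" "\<phi> \<in> selections C \<Omega> M"
    using assms by auto
  moreover have "mf_Inf \<Omega> S \<omega> \<subseteq> \<phi> \<omega>" if "\<omega> \<in> \<Omega>" "\<phi> \<in> S" for \<omega> \<phi>
    using that by (auto simp: mf_Inf_def)
  ultimately have "mf_Inf \<Omega> S \<in> selections C \<Omega> M"
    by (fastforce simp: selections_def multifuns_def mf_le_def PiE_def Pi_def)
  then show ?thesis
    by (auto simp: is_greatest_def mf_le_def mf_Inf_def)
qed

text \<open>
  Ordinals are represented by well-order relations, compared by \<open>\<le>o\<close>. The ordinals smaller than that
  of \<open>r\<close> are those of the proper initial segments \<open>ord_seg r a\<close> with \<open>a \<in> Field r\<close>. The
  ordinal of \<open>r\<close> is a successor iff \<open>r\<close> has a maximum \<open>m\<close>; its predecessor is then that of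
  \<open>ord_seg r m\<close>.
\<close>

definition ord_seg :: "'o rel \<Rightarrow> 'o \<Rightarrow> 'o rel" where
  "ord_seg r a = Restr r (underS r a)"

definition is_max :: "'o rel \<Rightarrow> 'o \<Rightarrow> bool" where
  "is_max r m \<longleftrightarrow> m \<in> Field r \<and> (\<forall>a\<in>Field r. (a, m) \<in> r)"

text \<open>
  \<open>transfinite_iter g L \<phi> r\<close> is \<open>g\<^sup>\<beta>(\<phi>)\<close>, where \<open>\<beta>\<close> is the ordinal of \<open>r\<close> and \<open>L\<close> forms the
  greatest lower bound of the set of earlier iterates at limit ordinals. The value is a dummy if \<open>r\<close>
  is not a well-order.
\<close>

function transfinite_iter :: "('m \<Rightarrow> 'm) \<Rightarrow> ('m set \<Rightarrow> 'm) \<Rightarrow> 'm \<Rightarrow> 'o rel \<Rightarrow> 'm" where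
  "transfinite_iter g L \<phi> r =
     (if \<not> Well_order r \<or> Field r = {} then \<phi>
      else if \<exists>m. is_max r m then g (transfinite_iter g L \<phi> (ord_seg r (THE m. is_max r m)))
      else L ((\<lambda>a. transfinite_iter g L \<phi> (ord_seg r a)) ` Field r))"
  by pat_completeness auto
termination
proof (relation "inv_image ordLess (\<lambda>(g, L, \<phi>, r). r)")
  show "wf (inv_image ordLess (\<lambda>(g, L, \<phi>, r). r))"
    using wf_ordLess by (rule wf_inv_image)
qed (auto simp: ord_seg_def intro: underS_Restr_ordLess)

declare transfinite_iter.simps [simp del]

lemma transfinite_iter_zero: "Field r = {} \<Longrightarrow> transfinite_iter g L \<phi> r = \<phi>"
  by (simp add: transfinite_iter.simps)

lemma transfinite_iter_succ:
  assumes "Well_order r" "is_max r m"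
  shows "transfinite_iter g L \<phi> r = g (transfinite_iter g L \<phi> (ord_seg r m))"
proof -
  have "antisym r"
    using assms(1) by (simp add: order_on_defs)
  then have "(THE m. is_max r m) = m"
    using assms(2) by (intro the_equality) (auto simp: is_max_def dest: antisymD)
  moreover have "Field r \<noteq> {}"
    using assms(2) by (auto simp: is_max_def)
  moreover have "\<exists>m. is_max r m"
    using assms(2) by blast
  ultimately show ?thesis
    using assms(1) by (simp only: transfinite_iter.simps[of g L \<phi> r] if_True if_False not_not simp_thms)
qed

lemma transfinite_iter_limit:
  assumes "Well_order r" "Field r \<noteq> {}" "\<nexists>m. is_max r m"
  shows "transfinite_iter g L \<phi> r = L ((\<lambda>a. transfinite_iter g L \<phi> (ord_seg r a)) ` Field r)"
  by (simp only: transfinite_iter.simps[of g L \<phi> r] assms if_True if_False not_not simp_thms)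

end

theory Submission
  imports Defs
begin

text \<open>
  Every \<open>\<phi>\<close> with values in \<open>\<P>(C)\<close> satisfies
  \<open>\<gamma>(\<phi>)(\<omega>) = {f \<in> \<phi>(\<omega>). f|A \<in> [\<phi>](-\<omega>|A) for all A}\<close>: the auxiliary \<open>h\<close> in the definition of
  \<open>\<gamma>\<close> may be taken to be \<open>f\<close> itself. So \<open>\<gamma>(\<phi>) = \<phi>\<close> says that for each \<open>f \<in> \<phi>(\<omega>)\<close> the restriction
  \<open>f|A\<close> extends to an element of \<open>\<phi>(\<nu>)\<close> whenever \<open>\<nu>\<close> agrees with \<open>\<omega>\<close> on \<open>A\<close>, which is
  non-anticipation (\<open>gamma_fixed_iff_non_anticipating\<close>). By the same formula \<open>\<gamma>\<close> is
  deflationary (\<open>gamma_le\<close>), and it is monotone (\<open>gamma_mono\<close>) since enlarging \<open>\<phi>\<close> enlarges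
  the brackets.

  What remains is order theory: iterating a monotone deflationary map downwards from the top element,
  with infima at limits, one stays above every fixed point, and the iterates decrease. Two equal
  iterates at different stages force a fixed point at the earlier stage, after which the iteration
  is constant. So if the iterate at \<open>\<alpha>\<close> were not fixed, the earlier iterates would be
  distinct and \<open>\<alpha>\<close> would inject into the set of selections, against
  \<open>|selections|\<^sup>+ \<le> \<alpha>\<close> (\<open>iter_fixed\<close>). The iterate at \<open>\<alpha>\<close> is therefore a fixed point,
  and it lies above all others.
\<close>

section \<open>Initial segments of well-orders\<close>

lemma Well_order_ord_seg: "Well_order r \<Longrightarrow> Well_order (ord_seg r a)"
  unfolding ord_seg_def by (rule Well_order_Restr)

lemma Field_ord_seg:
  assumes "Well_order r"
  shows "Field (ord_seg r a) = underS r a"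
proof -
  have "Refl r" using assms by (simp add: order_on_defs)
  then have "Field (Restr r (underS r a)) = Field r \<inter> underS r a" by (rule Refl_Field_Restr)
  then show ?thesis by (auto simp: ord_seg_def underS_def Field_def)
qed

lemma ord_seg_ord_seg:
  assumes "Well_order r" "a \<in> underS r b"
  shows "ord_seg (ord_seg r b) a = ord_seg r a"
proof -
  have "trans r" "antisym r" using assms(1) by (simp_all add: order_on_defs)
  then have sub: "underS r a \<subseteq> underS r b"
    using assms(2) by (auto simp: underS_def dest: transD antisymD)
  then have "underS (ord_seg r b) a = underS r a"
    using assms(2) by (auto simp: ord_seg_def underS_def)
  with sub show ?thesis by (auto simp: ord_seg_def)
qed

text \<open>
  Transfinite induction over ordinals, phrased for well-orders on a fixed type. It is justified
  because proper initial segments are smaller with respect to the well-founded relation \<open><o\<close>.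
\<close>

lemma Well_order_induct [consumes 1, case_names zero succ limit]:
  assumes "Well_order r"
    and zero: "\<And>r. Well_order r \<Longrightarrow> Field r = {} \<Longrightarrow> P r"
    and succ: "\<And>r m. Well_order r \<Longrightarrow> is_max r m \<Longrightarrow> P (ord_seg r m) \<Longrightarrow> P r"
    and limit: "\<And>r. Well_order r \<Longrightarrow> Field r \<noteq> {} \<Longrightarrow> \<nexists>m. is_max r m \<Longrightarrow>
      (\<And>a. a \<in> Field r \<Longrightarrow> P (ord_seg r a)) \<Longrightarrow> P r"
  shows "P r"
  using wf_ordLess assms(1)
proof (induction r rule: wf_induct_rule)
  case (less r)
  have IH: "P (ord_seg r a)" if "a \<in> Field r" for a
  proof (rule less.IH)
    show "(ord_seg r a, r) \<in> ordLess"
      using that less.prems by (auto simp: ord_seg_def intro: underS_Restr_ordLess)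
  qed (rule Well_order_ord_seg[OF less.prems])
  consider "Field r = {}" | m where "is_max r m" | "Field r \<noteq> {}" "\<nexists>m. is_max r m" by blast
  then show ?case
  proof cases
    case 1 then show ?thesis using zero less.prems by blast
  next
    case 2
    then show ?thesis using succ[OF less.prems 2] IH by (simp add: is_max_def)
  next
    case 3 then show ?thesis using limit less.prems IH by blast
  qed
qed

section \<open>Iterating a monotone deflationary map\<close>

locale downward_iteration =
  fixes S :: "'m set" and le :: "'m \<Rightarrow> 'm \<Rightarrow> bool" and g :: "'m \<Rightarrow> 'm" and L :: "'m set \<Rightarrow> 'm"
    and top :: 'm
  assumes le_refl: "x \<in> S \<Longrightarrow> le x x"
    and le_trans: "x \<in> S \<Longrightarrow> y \<in> S \<Longrightarrow> z \<in> S \<Longrightarrow> le x y \<Longrightarrow> le y z \<Longrightarrow> le x z"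
    and le_antisym: "x \<in> S \<Longrightarrow> y \<in> S \<Longrightarrow> le x y \<Longrightarrow> le y x \<Longrightarrow> x = y"
    and g_closed: "x \<in> S \<Longrightarrow> g x \<in> S"
    and g_le: "x \<in> S \<Longrightarrow> le (g x) x"
    and g_mono: "x \<in> S \<Longrightarrow> y \<in> S \<Longrightarrow> le x y \<Longrightarrow> le (g x) (g y)"
    and L_closed: "A \<noteq> {} \<Longrightarrow> A \<subseteq> S \<Longrightarrow> L A \<in> S"
    and L_lower: "A \<subseteq> S \<Longrightarrow> x \<in> A \<Longrightarrow> le (L A) x"
    and L_greatest: "A \<noteq> {} \<Longrightarrow> A \<subseteq> S \<Longrightarrow> z \<in> S \<Longrightarrow> (\<And>x. x \<in> A \<Longrightarrow> le z x) \<Longrightarrow> le z (L A)"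
    and top_closed: "top \<in> S"
    and le_top: "x \<in> S \<Longrightarrow> le x top"
begin

abbreviation iter :: "'o rel \<Rightarrow> 'm" where
  "iter \<equiv> transfinite_iter g L top"

lemma iter_closed:
  assumes "Well_order r"
  shows "iter r \<in> S"
  using assms
proof (induction rule: Well_order_induct)
  case (zero r)
  then show ?case by (simp add: transfinite_iter_zero top_closed)
next
  case (succ r m)
  then show ?case by (simp add: transfinite_iter_succ g_closed)
next
  case (limit r)
  then show ?case by (auto simp: transfinite_iter_limit intro!: L_closed)
qed

lemma fixed_le_iter:
  assumes "Well_order r" "z \<in> S" "g z = z"
  shows "le z (iter r)"
  using assms(1)
proof (induction rule: Well_order_induct)
  case (zero r)
  then show ?case by (simp add: transfinite_iter_zero le_top assms)
next
  case (succ r m)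
  have "le (g z) (g (iter (ord_seg r m)))"
    using succ assms by (intro g_mono iter_closed Well_order_ord_seg)
  then show ?case using succ assms by (simp add: transfinite_iter_succ)
next
  case (limit r)
  then show ?case
    by (auto simp: transfinite_iter_limit intro!: L_greatest iter_closed Well_order_ord_seg assms)
qed

text \<open>
  The iterates decrease. The bound is by the \<^emph>\<open>successor\<close> of the earlier iterate, because this
  is what turns equality of two iterates into a fixed point.
\<close>

lemma iter_le_succ:
  assumes "Well_order r" "a \<in> Field r"
  shows "le (iter r) (g (iter (ord_seg r a)))"
  using assms
proof (induction arbitrary: a rule: Well_order_induct)
  case (zero r)
  then show ?case by simp
next
  case (succ r m)
  note closed = iter_closed[OF Well_order_ord_seg[OF succ.hyps(1)]]
  show ?case
  proof (cases "a = m")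
    case True
    with succ.hyps show ?thesis by (simp add: transfinite_iter_succ le_refl g_closed closed)
  next
    case False
    then have a: "a \<in> underS r m"
      using succ.hyps succ.prems by (auto simp: is_max_def underS_def)
    then have "le (iter (ord_seg r m)) (g (iter (ord_seg r a)))"
      using succ.IH[of a] succ.hyps(1) by (simp add: Field_ord_seg ord_seg_ord_seg)
    then have "le (g (iter (ord_seg r m))) (g (iter (ord_seg r a)))"
      using le_trans g_le g_closed closed by blast
    with succ.hyps show ?thesis by (simp add: transfinite_iter_succ)
  qed
next
  case (limit r)
  note closed = iter_closed[OF Well_order_ord_seg[OF limit.hyps(1)]]
  obtain b where b: "b \<in> Field r" "(b, a) \<notin> r"
    using limit.hyps(3) limit.prems by (auto simp: is_max_def)
  have "Total r" "Refl r" using limit.hyps(1) by (simp_all add: order_on_defs)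
  then have a: "a \<in> underS r b"
    using b limit.prems by (cases "a = b") (auto simp: underS_def total_on_def refl_on_def)
  let ?A = "(\<lambda>c. iter (ord_seg r c)) ` Field r"
  have A: "?A \<subseteq> S" "?A \<noteq> {}" using closed limit.hyps by auto
  have "le (L ?A) (iter (ord_seg r b))" using b A by (intro L_lower) auto
  moreover have "le (iter (ord_seg r b)) (g (iter (ord_seg r a)))"
    using limit.IH[OF b(1), of a] limit.hyps(1) a by (simp add: Field_ord_seg ord_seg_ord_seg)
  ultimately have "le (L ?A) (g (iter (ord_seg r a)))"
    using le_trans[OF L_closed[OF A(2,1)] closed g_closed[OF closed]] by blast
  with limit.hyps show ?case by (simp add: transfinite_iter_limit)
qed

text \<open>
  Once a fixed point is reached the iteration is constant: the later iterates lie below it because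
  they decrease, and above it by \<open>fixed_le_iter\<close>.
\<close>

lemma iter_eq_fixed_segment:
  assumes "Well_order r" "a \<in> Field r" "g (iter (ord_seg r a)) = iter (ord_seg r a)"
  shows "iter r = iter (ord_seg r a)"
proof (rule le_antisym)
  show "iter r \<in> S" "iter (ord_seg r a) \<in> S"
    using assms(1) by (auto intro: iter_closed Well_order_ord_seg)
  show "le (iter r) (iter (ord_seg r a))" using iter_le_succ[OF assms(1,2)] assms(3) by simp
  show "le (iter (ord_seg r a)) (iter r)"
    using assms by (intro fixed_le_iter iter_closed Well_order_ord_seg)
qed

lemma inj_on_iter_segments:
  assumes r: "Well_order r" and nfix: "g (iter r) \<noteq> iter r"
  shows "inj_on (\<lambda>a. iter (ord_seg r a)) (Field r)"
proof -
  note closed = iter_closed[OF Well_order_ord_seg[OF r]]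
  have neq: "iter (ord_seg r a) \<noteq> iter (ord_seg r b)" if a: "a \<in> underS r b" for a b
  proof
    assume eq: "iter (ord_seg r a) = iter (ord_seg r b)"
    have "le (iter (ord_seg r b)) (g (iter (ord_seg r a)))"
      using iter_le_succ[OF Well_order_ord_seg[OF r, of b], of a] a r
      by (simp add: Field_ord_seg ord_seg_ord_seg)
    then have "g (iter (ord_seg r a)) = iter (ord_seg r a)"
      using eq closed g_closed g_le le_antisym by metis
    moreover have "a \<in> Field r" using a by (auto simp: underS_def Field_def)
    ultimately show False using iter_eq_fixed_segment[OF r] nfix by metis
  qed
  have "Total r" using r by (simp add: order_on_defs)
  then have "a \<in> underS r b \<or> b \<in> underS r a" if "a \<in> Field r" "b \<in> Field r" "a \<noteq> b" for a b
    using that by (auto simp: underS_def total_on_def)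
  with neq show ?thesis unfolding inj_on_def by metis
qed

lemma iter_fixed:
  fixes r :: "'o rel"
  assumes r: "Well_order r" and large: "cardSuc |S| \<le>o r"
  shows "g (iter r) = iter r"
proof (rule ccontr)
  assume "g (iter r) \<noteq> iter r"
  then have "inj_on (\<lambda>a. iter (ord_seg r a)) (Field r)" by (rule inj_on_iter_segments[OF r])
  moreover have "(\<lambda>a. iter (ord_seg r a)) ` Field r \<subseteq> S"
    using r by (auto intro: iter_closed Well_order_ord_seg)
  ultimately have small: "|Field r| \<le>o |S|" using card_of_ordLeq by blast
  \<comment> \<open>Only the cardinality of \<open>r\<close> matters: a cardinal below the ordinal \<open>r\<close> is below \<open>|r|\<close>.\<close>
  have "cardSuc |S| =o |Field (cardSuc |S| )|"
    by (rule ordIso_symmetric) (intro card_of_Field_ordIso cardSuc_Card_order card_of_Card_order)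
  also have "|Field (cardSuc |S| )| \<le>o |Field r|" using large by (rule card_of_mono2)
  also note small
  finally have "cardSuc |S| \<le>o |S|" .
  moreover have "|S| <o cardSuc |S|" by (intro cardSuc_greater card_of_Card_order)
  ultimately show False using not_ordLess_ordLeq by blast
qed

end

section \<open>The map \<open>\<gamma>\<close>\<close>

lemma selectionsD:
  assumes "\<phi> \<in> selections C \<Omega> M"
  shows "\<phi> \<in> extensional \<Omega>" "\<omega> \<in> \<Omega> \<Longrightarrow> \<phi> \<omega> \<subseteq> C"
  using assms by (auto simp: selections_def multifuns_def PiE_def)

lemma restrict_mem_restr_set: "f \<in> F \<Longrightarrow> restrict f A \<in> restr_set F A"
  by (simp add: restr_set_def)

lemma mf_le_antisym:
  assumes "\<phi> \<in> extensional \<Omega>" "\<psi> \<in> extensional \<Omega>" "mf_le \<Omega> \<phi> \<psi>" "mf_le \<Omega> \<psi> \<phi>"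
  shows "\<phi> = \<psi>"
  using assms by (intro extensionalityI[of _ \<Omega>]) (auto simp: mf_le_def)

lemma mem_gamma_iff:
  assumes "\<X> \<noteq> {}" "\<omega> \<in> \<Omega>" "\<phi> \<omega> \<subseteq> C"
  shows "f \<in> gamma C \<Omega> \<X> \<phi> \<omega> \<longleftrightarrow>
    f \<in> \<phi> \<omega> \<and> (\<forall>A\<in>\<X>. restrict f A \<in> bracket C \<Omega> \<phi> \<omega> A)"
proof -
  have "f \<in> (\<Union>h\<in>{h \<in> C. restrict h A \<in> bracket C \<Omega> \<phi> \<omega> A}. agreeing (\<phi> \<omega>) h A) \<longleftrightarrow>
      f \<in> \<phi> \<omega> \<and> restrict f A \<in> bracket C \<Omega> \<phi> \<omega> A" for A
    using assms(3) by (auto simp: agreeing_def)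
  with assms(1,2) show ?thesis by (auto simp: gamma_def)
qed

text \<open>For \<open>f \<in> C\<close> the convention for empty intersections is the general case, vacuously.\<close>

lemma restrict_mem_bracket_iff:
  assumes "f \<in> C"
  shows "restrict f A \<in> bracket C \<Omega> \<phi> \<omega> A \<longleftrightarrow>
    (\<forall>\<nu>\<in>\<Omega>. restrict \<nu> A = restrict \<omega> A \<longrightarrow> \<nu> \<noteq> \<omega> \<longrightarrow> restrict f A \<in> restr_set (\<phi> \<nu>) A)"
  using restrict_mem_restr_set[OF assms, of A] by (auto simp: bracket_def agreeing_def)

lemma gamma_le:
  assumes "\<X> \<noteq> {}" "\<phi> \<in> selections C \<Omega> M"
  shows "mf_le \<Omega> (gamma C \<Omega> \<X> \<phi>) \<phi>"
proof -
  have "gamma C \<Omega> \<X> \<phi> \<omega> \<subseteq> \<phi> \<omega>" if "\<omega> \<in> \<Omega>" for \<omega>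
    using mem_gamma_iff[where \<phi> = \<phi>, OF assms(1) that selectionsD(2)[OF assms(2) that]] by auto
  then show ?thesis by (simp add: mf_le_def)
qed

lemma gamma_mono:
  assumes X: "\<X> \<noteq> {}"
    and \<phi>: "\<phi> \<in> selections C \<Omega> M" and \<psi>: "\<psi> \<in> selections C \<Omega> M" and le: "mf_le \<Omega> \<phi> \<psi>"
  shows "mf_le \<Omega> (gamma C \<Omega> \<X> \<phi>) (gamma C \<Omega> \<X> \<psi>)"
proof -
  have mono: "restr_set (\<phi> \<nu>) A \<subseteq> restr_set (\<psi> \<nu>) A" if "\<nu> \<in> \<Omega>" for \<nu> A
    using le that by (auto simp: mf_le_def restr_set_def)
  have "f \<in> gamma C \<Omega> \<X> \<psi> \<omega>" if "\<omega> \<in> \<Omega>" and f: "f \<in> gamma C \<Omega> \<X> \<phi> \<omega>" for f \<omega>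
  proof -
    have C: "\<phi> \<omega> \<subseteq> C" "\<psi> \<omega> \<subseteq> C"
      using selectionsD(2)[OF \<phi>] selectionsD(2)[OF \<psi>] \<open>\<omega> \<in> \<Omega>\<close> by auto
    note iff = mem_gamma_iff[OF X \<open>\<omega> \<in> \<Omega>\<close>]
    have f\<phi>: "f \<in> \<phi> \<omega>" "\<And>A. A \<in> \<X> \<Longrightarrow> restrict f A \<in> bracket C \<Omega> \<phi> \<omega> A"
      using f iff[where \<phi> = \<phi>, OF C(1)] by auto
    then have "f \<in> C" using C(1) by blast
    then have "restrict f A \<in> bracket C \<Omega> \<psi> \<omega> A" if "A \<in> \<X>" for A
      using f\<phi>(2)[OF that] mono by (fastforce simp: restrict_mem_bracket_iff)
    moreover have "f \<in> \<psi> \<omega>" using f\<phi>(1) le \<open>\<omega> \<in> \<Omega>\<close> by (auto simp: mf_le_def)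
    ultimately show ?thesis using iff[where \<phi> = \<psi>, OF C(2)] by blast
  qed
  then show ?thesis by (auto simp: mf_le_def)
qed

text \<open>
  The bracket omits \<open>\<omega>\<close> itself, whereas non-anticipation compares \<open>\<omega>\<close> with every \<open>\<omega>'\<close>
  agreeing with it on \<open>A\<close>; the additional instance \<open>\<omega>' = \<omega>\<close> is trivial.
\<close>

lemma gamma_fixed_iff_non_anticipating:
  assumes X: "\<X> \<noteq> {}" and \<phi>: "\<phi> \<in> selections C \<Omega> M"
  shows "gamma C \<Omega> \<X> \<phi> = \<phi> \<longleftrightarrow> non_anticipating \<Omega> \<X> \<phi>"
proof -
  note sel = selectionsD[OF \<phi>]
  have "gamma C \<Omega> \<X> \<phi> = \<phi> \<longleftrightarrow> (\<forall>\<omega>\<in>\<Omega>. \<phi> \<omega> \<subseteq> gamma C \<Omega> \<X> \<phi> \<omega>)"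
    using gamma_le[OF X \<phi>] mf_le_antisym[OF selectionsD(1)[OF gamma_selections[OF X \<phi>]] sel(1)]
    by (auto simp: mf_le_def)
  also have "\<dots> \<longleftrightarrow> (\<forall>\<omega>\<in>\<Omega>. \<forall>f\<in>\<phi> \<omega>. \<forall>A\<in>\<X>. restrict f A \<in> bracket C \<Omega> \<phi> \<omega> A)"
    using sel(2) by (auto simp: mem_gamma_iff[OF X] subset_iff)
  also have "\<dots> \<longleftrightarrow> (\<forall>\<omega>\<in>\<Omega>. \<forall>f\<in>\<phi> \<omega>. \<forall>A\<in>\<X>. \<forall>\<nu>\<in>\<Omega>.
      restrict \<nu> A = restrict \<omega> A \<longrightarrow> \<nu> \<noteq> \<omega> \<longrightarrow> restrict f A \<in> restr_set (\<phi> \<nu>) A)"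
    using sel(2) by (intro ball_cong refl restrict_mem_bracket_iff) auto
  also have "\<dots> \<longleftrightarrow> (\<forall>\<omega>\<in>\<Omega>. \<forall>f\<in>\<phi> \<omega>. \<forall>A\<in>\<X>. \<forall>\<nu>\<in>\<Omega>.
      restrict \<nu> A = restrict \<omega> A \<longrightarrow> restrict f A \<in> restr_set (\<phi> \<nu>) A)"
    by (metis restrict_mem_restr_set)
  also have "\<dots> \<longleftrightarrow> non_anticipating \<Omega> \<X> \<phi>"
    unfolding non_anticipating_def restr_set_def image_subset_iff by blast
  finally show ?thesis .
qed

lemma downward_iteration_gamma:
  assumes X: "\<X> \<noteq> {}" and M: "M \<in> multifuns C \<Omega>"
  shows "downward_iteration (selections C \<Omega> M) (mf_le \<Omega>) (gamma C \<Omega> \<X>) (mf_Inf \<Omega>) M"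
proof
  fix A \<psi> assume A: "A \<subseteq> selections C \<Omega> M"
  show "mf_Inf \<Omega> A \<in> selections C \<Omega> M" if "A \<noteq> {}"
    using is_greatest_mf_Inf[OF that A] by (simp add: is_greatest_def)
  show "mf_le \<Omega> (mf_Inf \<Omega> A) \<psi>" if "\<psi> \<in> A"
    using is_greatest_mf_Inf[OF _ A] that by (auto simp: is_greatest_def)
  show "mf_le \<Omega> \<psi> (mf_Inf \<Omega> A)"
    if "A \<noteq> {}" "\<psi> \<in> selections C \<Omega> M" "\<And>\<phi>. \<phi> \<in> A \<Longrightarrow> mf_le \<Omega> \<psi> \<phi>"
    using is_greatest_mf_Inf[OF that(1) A] that(2,3) by (simp add: is_greatest_def)
next
  show "M \<in> selections C \<Omega> M" using M by (simp add: selections_def mf_le_def)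
next
  fix \<phi> \<psi> assume "\<phi> \<in> selections C \<Omega> M" "\<psi> \<in> selections C \<Omega> M" "mf_le \<Omega> \<phi> \<psi>" "mf_le \<Omega> \<psi> \<phi>"
  then show "\<phi> = \<psi>" using mf_le_antisym selectionsD(1) by blast
next
  fix \<phi> assume "\<phi> \<in> selections C \<Omega> M"
  then show "gamma C \<Omega> \<X> \<phi> \<in> selections C \<Omega> M" "mf_le \<Omega> (gamma C \<Omega> \<X> \<phi>) \<phi>" "mf_le \<Omega> \<phi> M"
    using gamma_selections[OF X] gamma_le[OF X] by (blast, blast, simp add: selections_def)
next
  fix \<phi> \<psi> assume "\<phi> \<in> selections C \<Omega> M" "\<psi> \<in> selections C \<Omega> M" "mf_le \<Omega> \<phi> \<psi>"
  then show "mf_le \<Omega> (gamma C \<Omega> \<X> \<phi>) (gamma C \<Omega> \<X> \<psi>)" by (rule gamma_mono[OF X])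
qed (auto simp: mf_le_def)

section \<open>The greatest non-anticipating selection\<close>

theorem mainTheorem9:
  fixes I :: "'i set" and X :: "'x set" and Y :: "'y set"
    and C :: "('i \<Rightarrow> 'x) set" and \<Omega> :: "('i \<Rightarrow> 'y) set" and \<X> :: "'i set set"
    and M :: "('i, 'x, 'y) multifun" and \<alpha> :: "'o rel"
  assumes "I \<noteq> {}" and "X \<noteq> {}" and "Y \<noteq> {}"
    and "C \<subseteq> I \<rightarrow>\<^sub>E X" and "C \<noteq> {}"
    and "\<Omega> \<subseteq> I \<rightarrow>\<^sub>E Y" and "\<Omega> \<noteq> {}"
    and "\<X> \<subseteq> Pow I" and "\<X> \<noteq> {}"
    and "M \<in> multifuns C \<Omega>"
    and "Well_order \<alpha>" and "cardSuc |selections C \<Omega> M| \<le>o \<alpha>"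
  shows "\<exists>\<phi>. is_greatest \<Omega> {\<psi> \<in> selections C \<Omega> M. non_anticipating \<Omega> \<X> \<psi>} \<phi>
      \<and> is_greatest \<Omega> {\<psi> \<in> selections C \<Omega> M. gamma C \<Omega> \<X> \<psi> = \<psi>} \<phi>
      \<and> \<phi> = transfinite_iter (gamma C \<Omega> \<X>) (mf_Inf \<Omega>) M \<alpha>"
proof -
  interpret downward_iteration "selections C \<Omega> M" "mf_le \<Omega>" "gamma C \<Omega> \<X>" "mf_Inf \<Omega>" M
    by (rule downward_iteration_gamma[OF \<open>\<X> \<noteq> {}\<close> \<open>M \<in> multifuns C \<Omega>\<close>])
  have greatest: "is_greatest \<Omega> {\<psi> \<in> selections C \<Omega> M. gamma C \<Omega> \<X> \<psi> = \<psi>} (iter \<alpha>)"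
    using assms(11,12) by (simp add: is_greatest_def iter_closed iter_fixed fixed_le_iter)
  have "{\<psi> \<in> selections C \<Omega> M. non_anticipating \<Omega> \<X> \<psi>} =
      {\<psi> \<in> selections C \<Omega> M. gamma C \<Omega> \<X> \<psi> = \<psi>}"
    using gamma_fixed_iff_non_anticipating[OF \<open>\<X> \<noteq> {}\<close>] by blast
  with greatest show ?thesis by simp
qed

end
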